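(* Let $S$ be a nonempty set, let $F$ be $\mathbb{Q}$, $\mathbb{R}$ or $\mathbb{C}$, let $B$ be a Banach space over $F$, let $I$ be a nonempty index set, and let $\{p_i:S\to F\setminus\{0\}\}_{i\in I}$, $\{\rho_i:S\to S\}_{i\in I}$ and $\{\psi_i:S\to[0,\infty)\}_{i\in I}$ be families of functions. Assume that: (1) there is a family of positive real numbers $\{L_i\}_{i\in I}$ with $L_i<1$ and $\psi_i(\rho_i(x))\le L_i\,|p_i(\rho_i(x))|\,\psi_i(x)$ for all $x\in S$ and $i\in I$; (2) $\rho_i\circ\rho_j=\rho_j\circ\rho_i$ for all $i,j\in I$; (3) $p_i(\rho_j(x))=p_i(x)$ for all $x\in S$ and all distinct $i,j\in I$; (4) $\displaystyle\lim_{n\to\infty}\frac{\theta_{i,n}(\rho_j^n(x))}{|P_{j,n}(x)|}=0$ for all $x\in S$ and all distinct $i,j\in I$. Then for every function $f:S\to B$ satisfying $$\|f(\rho_i(x))-p_i(x)f(x)\|\le\psi_i(x)\quad\text{for all }x\in S\text{ and }i\in I,$$ there exists a unique function $T:S\to B$ such that $$T(\rho_i(x))=p_i(x)T(x)\quad\text{for all }x\in S\text{ and }i\in I$$ and $$\|f(x)-T(x)\|\le\inf_{i\in I}\frac{\psi_i(x)}{(1-L_i)|p_i(x)|}\quad\text{for all }x\in S.$$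
   Context: For $i\in I$, a positive integer $n$ and $x\in S$, $$P_{i,n}(x)=\prod_{k=0}^{n-1}p_i(\rho_i^k(x)),\qquad \theta_{i,n}(x)=\frac{(1-L_i^n)\,\psi_i(x)}{(1-L_i)\,|p_i(x)|},$$ where $\rho_i^k$ is the $k$-fold iterate of $\rho_i$ (with $\rho_i^0$ the identity) and $\{L_i\}$ is the family in hypothesis (1). A Banach space over $F$ is a complete normed vector space over $F$, with $F$ carrying the usual absolute value. *)

theory Defs
  imports "HOL-Analysis.Abstract_Metric_Spaces"
begin

text \<open>
  The scalar field is a type \<open>'f\<close> identified, by a field isomorphism \<open>e\<close>, with one of the
  subfields \<open>\<rat>\<close>, \<open>\<real>\<close>, \<open>\<complex>\<close> of the complex numbers; \<open>av\<close> is the usual absolute value carried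
  over by \<open>e\<close> (which is injective, being a unital homomorphism of fields). An explicit function
  \<open>av\<close> is needed because type \<^typ>\<open>rat\<close> is not in class \<^class>\<open>real_normed_field\<close>.
\<close>

definition rat_real_complex_abs :: "('f::field \<Rightarrow> real) \<Rightarrow> bool"
  where "rat_real_complex_abs av \<longleftrightarrow>
    (\<exists>e :: 'f \<Rightarrow> complex.
        e 1 = 1 \<and> (\<forall>a b. e (a + b) = e a + e b) \<and> (\<forall>a b. e (a * b) = e a * e b) \<and>
        (range e = \<rat> \<or> range e = \<real> \<or> range e = UNIV) \<and>
        (\<forall>a. av a = cmod (e a)))"

lemma rat_real_complex_abs_rat: "rat_real_complex_abs (\<lambda>a::rat. real_of_rat \<bar>a\<bar>)"
  unfolding rat_real_complex_abs_def
proof (intro exI[of _ "of_rat :: rat \<Rightarrow> complex"] conjI allI)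
  fix a :: rat
  have "(of_rat a :: complex) = complex_of_real (of_rat a)"
    by (cases a) (simp add: of_rat_rat)
  then show "real_of_rat \<bar>a\<bar> = cmod (of_rat a)"
    by simp
qed (auto simp: of_rat_add of_rat_mult Rats_def)

lemma rat_real_complex_abs_real: "rat_real_complex_abs (abs :: real \<Rightarrow> real)"
  unfolding rat_real_complex_abs_def
  by (intro exI[of _ complex_of_real]) (auto simp: Reals_def)

lemma rat_real_complex_abs_complex: "rat_real_complex_abs cmod"
  unfolding rat_real_complex_abs_def by (intro exI[of _ "\<lambda>a. a"]) auto

text \<open>
  The overloaded \<open>norm\<close> of the library is reserved for real normed spaces, so over a general
  scalar field the norm \<open>nrm\<close> is a parameter.
\<close>

locale normed_space_over = vector_space scale
  for scale :: "'f::field \<Rightarrow> 'b::ab_group_add \<Rightarrow> 'b" +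
  fixes av :: "'f \<Rightarrow> real" and nrm :: "'b \<Rightarrow> real"
  assumes nrm_nonneg: "0 \<le> nrm x"
    and nrm_eq_0_iff: "nrm x = 0 \<longleftrightarrow> x = 0"
    and nrm_scale: "nrm (scale a x) = av a * nrm x"
    and nrm_triangle: "nrm (x + y) \<le> nrm x + nrm y"

locale banach_space_over = normed_space_over +
  assumes complete: "Metric_space.mcomplete UNIV (\<lambda>x y. nrm (x - y))"

text \<open>
  \<^const>\<open>Metric_space.mcomplete\<close> only has its intended meaning for a metric, hence the following check.
\<close>

lemma (in normed_space_over) Metric_space_nrm:
  assumes "rat_real_complex_abs av"
  shows "Metric_space UNIV (\<lambda>x y. nrm (x - y))"
proof
  obtain e :: "'f \<Rightarrow> complex" where e: "e 1 = 1" "\<And>a b. e (a + b) = e a + e b"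
      and av: "\<And>a. av a = cmod (e a)"
    using assms unfolding rat_real_complex_abs_def by blast
  have "e 0 = 0"
    using e(2)[of 0 0] by simp
  then have "e (- 1) = - 1"
    using e(1) e(2)[of "- 1" 1] by (simp add: eq_neg_iff_add_eq_0)
  then have "nrm (- x) = nrm x" for x
    using nrm_scale[of "- 1" x] by (simp add: av)
  then show "nrm (x - y) = nrm (y - x)" for x y
    by (metis minus_diff_eq)
  show "nrm (x - z) \<le> nrm (x - y) + nrm (y - z)" for x y z
    using nrm_triangle[of "x - y" "y - z"] by simp
qed (auto simp: nrm_nonneg nrm_eq_0_iff)

definition iter_prod :: "('i \<Rightarrow> 's \<Rightarrow> 'f::field) \<Rightarrow> ('i \<Rightarrow> 's \<Rightarrow> 's) \<Rightarrow> 'i \<Rightarrow> nat \<Rightarrow> 's \<Rightarrow> 'f"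
  where "iter_prod p \<rho> i n x = (\<Prod>k<n. p i ((\<rho> i ^^ k) x))"

definition theta ::
  "('f \<Rightarrow> real) \<Rightarrow> ('i \<Rightarrow> 's \<Rightarrow> 'f::field) \<Rightarrow> ('i \<Rightarrow> 's \<Rightarrow> real) \<Rightarrow> ('i \<Rightarrow> real) \<Rightarrow> 'i \<Rightarrow> nat \<Rightarrow> 's \<Rightarrow> real"
  where "theta av p \<psi> L i n x = ((1 - L i ^ n) * \<psi> i x) / ((1 - L i) * av (p i x))"

end

theory Submission
  imports Defs
begin

text \<open>
  For each \<open>i\<close> the direct method applies: by (1) the rescaled iterates
  \<open>f (\<rho>\<^sub>i\<^sup>n x) / P\<^sub>i\<^sub>,\<^sub>n(x)\<close> move by at most \<open>L\<^sub>i\<^sup>n \<psi>\<^sub>i(x) / |p\<^sub>i(x)|\<close> in step \<open>n\<close>, so they stay within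
  \<open>\<theta>\<^sub>i\<^sub>,\<^sub>n(x)\<close> of \<open>f(x)\<close> and converge to the only solution \<open>T\<^sub>i\<close> of the \<open>i\<close>-th equation near \<open>f\<close>.
  To see \<open>T\<^sub>i = T\<^sub>j\<close>, compare both sequences with \<open>f (\<rho>\<^sub>i\<^sup>n (\<rho>\<^sub>j\<^sup>n x)) / (P\<^sub>i\<^sub>,\<^sub>n(x) P\<^sub>j\<^sub>,\<^sub>n(x))\<close>, which is
  symmetric in \<open>i\<close> and \<open>j\<close> by (2) and (3): the distance to the \<open>j\<close>-th sequence is at most
  \<open>\<theta>\<^sub>i\<^sub>,\<^sub>n(\<rho>\<^sub>j\<^sup>n x) / |P\<^sub>j\<^sub>,\<^sub>n(x)|\<close>, which tends to \<open>0\<close> by (4).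
\<close>

section \<open>Absolute values and geometric convergence in the Banach space\<close>

lemma rat_real_complex_abs_props:
  assumes "rat_real_complex_abs av"
  shows "av (a * b) = av a * av b" and "av 1 = 1" and "0 \<le> av a" and "av a = 0 \<longleftrightarrow> a = 0"
proof -
  obtain e :: "'a \<Rightarrow> complex" where e: "e 1 = 1" "\<And>a b. e (a + b) = e a + e b"
      "\<And>a b. e (a * b) = e a * e b" and av: "\<And>a. av a = cmod (e a)"
    using assms unfolding rat_real_complex_abs_def by blast
  show "av (a * b) = av a * av b" "av 1 = 1" "0 \<le> av a"
    by (simp_all add: av e norm_mult)
  have "e 0 = 0"
    using e(2)[of 0 0] by simp
  \<comment> \<open>Units go to units: \<open>e a * e (inverse a) = e 1 = 1\<close>.\<close>
  moreover have "e a \<noteq> 0" if "a \<noteq> 0"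
    using e(3)[of a "inverse a"] e(1) that by auto
  ultimately show "av a = 0 \<longleftrightarrow> a = 0"
    by (auto simp: av)
qed

text \<open>Completeness is stated through \<open>Metric_space.mcomplete\<close>, and
  \<open>Metric_space_nrm\<close> relies on the condition on \<open>av\<close>; joining the two
  makes the metric \<open>sublocale\<close> below possible.\<close>

locale valued_banach_space = banach_space_over scale av nrm
  for scale :: "'f::field \<Rightarrow> 'b::ab_group_add \<Rightarrow> 'b" and av :: "'f \<Rightarrow> real" and nrm :: "'b \<Rightarrow> real" +
  assumes rat_real_complex_abs: "rat_real_complex_abs av"
begin

lemmas av_mult = rat_real_complex_abs_props(1)[OF rat_real_complex_abs]
  and av_1 = rat_real_complex_abs_props(2)[OF rat_real_complex_abs]
  and av_nonneg = rat_real_complex_abs_props(3)[OF rat_real_complex_abs]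
  and av_eq_0_iff = rat_real_complex_abs_props(4)[OF rat_real_complex_abs]

lemma av_pos: "a \<noteq> 0 \<Longrightarrow> 0 < av a"
  using av_nonneg[of a] av_eq_0_iff[of a] by linarith

lemma av_inverse: "av (inverse a) = inverse (av a)"
proof (cases "a = 0")
  case False
  then have "av (inverse a) * av a = 1"
    by (simp flip: av_mult add: av_1)
  then show ?thesis
    by (metis inverse_inverse_eq inverse_unique)
qed (use av_eq_0_iff[of 0] in simp)

sublocale Metric_space UNIV "\<lambda>x y. nrm (x - y)"
  using rat_real_complex_abs by (rule Metric_space_nrm)

lemma nrm_scale_inverse: "nrm (scale (inverse a) x) = nrm x / av a"
  by (simp add: nrm_scale av_inverse divide_inverse mult.commute)

text \<open>Telescoping plus a finite geometric sum. The factor \<open>1 - q ^ m\<close> is kept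
  because at \<open>n = 0\<close> it produces exactly the \<open>\<Theta>\<close> of
  \<open>rescaled_bound\<close>.\<close>

lemma geometric_steps_bound:
  assumes step: "\<And>n. nrm (g (Suc n) - g n) \<le> c * q ^ n" and q: "0 < q" "q < 1"
  shows "nrm (g (n + m) - g n) \<le> c * q ^ n * (1 - q ^ m) / (1 - q)"
proof (induction m)
  case 0
  then show ?case using nrm_eq_0_iff[of 0] by simp
next
  case (Suc m)
  have "nrm (g (n + Suc m) - g n) \<le> nrm (g (Suc (n + m)) - g (n + m)) + nrm (g (n + m) - g n)"
    using triangle by auto
  also have "\<dots> \<le> c * q ^ (n + m) + c * q ^ n * (1 - q ^ m) / (1 - q)"
    using step Suc.IH by (rule add_mono)
  also have "\<dots> = c * q ^ n * (1 - q ^ Suc m) / (1 - q)"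
    using q by (simp add: field_simps power_add)
  finally show ?case .
qed

lemma geometric_steps_converge:
  assumes step: "\<And>n. nrm (g (Suc n) - g n) \<le> c * q ^ n" and q: "0 < q" "q < 1"
  shows "\<exists>l. (\<lambda>n. nrm (g n - l)) \<longlonglongrightarrow> 0"
proof -
  \<comment> \<open>The case \<open>n = 0\<close> of \<open>step\<close>. The sign of
    \<open>c\<close> permits replacing \<open>1 - q ^ (n - N)\<close> by 1 below.\<close>
  have c: "0 \<le> c"
    using step[of 0] nrm_nonneg order_trans by fastforce
  have bound: "nrm (g n - g N) \<le> c * q ^ N / (1 - q)" if "N \<le> n" for n N
  proof -
    have "nrm (g n - g N) \<le> c * q ^ N * (1 - q ^ (n - N)) / (1 - q)"
      using geometric_steps_bound[OF step q, of N "n - N"] that by simp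
    also have "\<dots> \<le> c * q ^ N * 1 / (1 - q)"
      using c q by (intro divide_right_mono mult_left_mono) auto
    finally show ?thesis by simp
  qed
  have "MCauchy g"
    unfolding MCauchy_def
  proof (intro conjI allI impI)
    fix \<epsilon> :: real
    assume "0 < \<epsilon>"
    have "(\<lambda>N. c * q ^ N / (1 - q)) \<longlonglongrightarrow> c * 0 / (1 - q)"
      using q by (intro tendsto_intros LIMSEQ_realpow_zero) auto
    then have "\<forall>\<^sub>F N in sequentially. c * q ^ N / (1 - q) < \<epsilon> / 2"
      using \<open>0 < \<epsilon>\<close> by (intro order_tendstoD(2)) auto
    then obtain N where N: "c * q ^ N / (1 - q) < \<epsilon> / 2"
      using eventually_happens'[OF sequentially_bot] by blast
    have "nrm (g m - g n) < \<epsilon>" if "N \<le> m" "N \<le> n" for m n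
      using triangle[OF UNIV_I UNIV_I UNIV_I, of "g m" "g n" "g N"] commute[of "g n" "g N"]
        bound[OF that(1)] bound[OF that(2)] N by linarith
    then show "\<exists>N. \<forall>n n'. N \<le> n \<longrightarrow> N \<le> n' \<longrightarrow> nrm (g n - g n') < \<epsilon>"
      by blast
  qed auto
  then obtain l where "limitin mtopology g l sequentially"
    using complete unfolding mcomplete_def by blast
  then have "(\<lambda>n. nrm (g n - l)) \<longlonglongrightarrow> 0"
    by (simp add: limitin_metric_dist_null)
  then show ?thesis by blast
qed

lemma nrm_limit_unique:
  assumes "(\<lambda>n. nrm (g n - l)) \<longlonglongrightarrow> 0" and "(\<lambda>n. nrm (g n - l')) \<longlonglongrightarrow> 0"
  shows "l = l'"
proof -
  have "nrm (l - l') \<le> nrm (g n - l) + nrm (g n - l')" for n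
    using triangle[of l "g n" l'] commute[of l "g n"] by simp
  then have "nrm (l - l') \<le> 0 + 0"
    by (intro LIMSEQ_le_const[OF tendsto_add[OF assms]]) auto
  then show ?thesis
    using nrm_nonneg[of "l - l'"] nrm_eq_0_iff[of "l - l'"] by simp
qed

end

section \<open>A single equation: existence, error bound and uniqueness of its solution near
  \<open>f\<close>\<close>

locale approx_equation = valued_banach_space scale av nrm
  for scale :: "'f::field \<Rightarrow> 'b::ab_group_add \<Rightarrow> 'b" and av :: "'f \<Rightarrow> real" and nrm :: "'b \<Rightarrow> real" +
  fixes S :: "'s set" and p :: "'s \<Rightarrow> 'f" and \<rho> :: "'s \<Rightarrow> 's" and \<psi> :: "'s \<Rightarrow> real"
    and L :: real and f :: "'s \<Rightarrow> 'b"
  assumes p_nonzero: "x \<in> S \<Longrightarrow> p x \<noteq> 0"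
    and rho_maps: "x \<in> S \<Longrightarrow> \<rho> x \<in> S"
    and L_pos: "0 < L" and L_less_1: "L < 1"
    and psi_contr: "x \<in> S \<Longrightarrow> \<psi> (\<rho> x) \<le> L * av (p (\<rho> x)) * \<psi> x"
    and f_approx: "x \<in> S \<Longrightarrow> nrm (f (\<rho> x) - scale (p x) (f x)) \<le> \<psi> x"
begin

text \<open>\<open>P\<close> and, below, \<open>\<Theta>\<close> are \<open>iter_prod\<close> and
  \<open>theta\<close> for one fixed index; \<open>P_eq\<close> and \<open>g_bound\<close> in the
  final proof translate back.\<close>

definition P :: "nat \<Rightarrow> 's \<Rightarrow> 'f"
  where "P n x = (\<Prod>k<n. p ((\<rho> ^^ k) x))"

definition rescaled :: "nat \<Rightarrow> 's \<Rightarrow> 'b"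
  where "rescaled n x = scale (inverse (P n x)) (f ((\<rho> ^^ n) x))"

definition \<Theta> :: "nat \<Rightarrow> 's \<Rightarrow> real"
  where "\<Theta> n x = ((1 - L ^ n) * \<psi> x) / ((1 - L) * av (p x))"

lemma funpow_maps: "x \<in> S \<Longrightarrow> (\<rho> ^^ n) x \<in> S"
  by (induction n) (auto simp: rho_maps)

lemma P_Suc: "P (Suc n) x = p ((\<rho> ^^ n) x) * P n x"
  by (simp add: P_def mult.commute)

lemma P_Suc_left: "P (Suc n) x = p x * P n (\<rho> x)"
  unfolding P_def by (subst prod.lessThan_Suc_shift) (simp add: funpow_swap1)

lemma P_nonzero: "x \<in> S \<Longrightarrow> P n x \<noteq> 0"
  by (simp add: P_def p_nonzero funpow_maps)

text \<open>Each use of \<open>psi_contr\<close> costs \<open>L\<close> times the absolute value of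
  the next factor of \<open>P\<close>, so the quotient shrinks by \<open>L\<close>. The index is
  \<open>Suc n\<close> because the error made in step \<open>n\<close> is divided by
  \<open>P (Suc n) x\<close>.\<close>

lemma psi_iterate:
  assumes "x \<in> S"
  shows "\<psi> ((\<rho> ^^ n) x) / av (P (Suc n) x) \<le> \<psi> x / av (p x) * L ^ n"
proof (induction n)
  case 0
  then show ?case by (simp add: P_def)
next
  case (Suc n)
  let ?y = "(\<rho> ^^ n) x"
  have pos: "0 < av (P (Suc n) x)" "0 < av (p (\<rho> ?y))"
    using assms by (auto intro!: av_pos P_nonzero p_nonzero rho_maps funpow_maps)
  have "\<psi> (\<rho> ?y) / av (P (Suc (Suc n)) x) \<le> (L * av (p (\<rho> ?y)) * \<psi> ?y) / av (P (Suc (Suc n)) x)"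
    using psi_contr[OF funpow_maps[OF assms]] av_nonneg by (rule divide_right_mono)
  also have "\<dots> = L * (\<psi> ?y / av (P (Suc n) x))"
    using pos by (simp add: P_Suc[of "Suc n"] av_mult)
  also have "\<dots> \<le> L * (\<psi> x / av (p x) * L ^ n)"
    using Suc.IH L_pos by (intro mult_left_mono) auto
  finally show ?case by (simp add: mult_ac)
qed

lemma rescaled_step:
  assumes "x \<in> S"
  shows "nrm (rescaled (Suc n) x - rescaled n x) \<le> \<psi> x / av (p x) * L ^ n"
proof -
  let ?y = "(\<rho> ^^ n) x"
  have y: "?y \<in> S" using assms by (rule funpow_maps)
  \<comment> \<open>Over the common denominator \<open>P (Suc n) x\<close>, the term with
    \<open>P n x\<close> acquires the factor \<open>p ?y\<close>, which exposes the defect of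
    \<open>f\<close> at \<open>?y\<close>.\<close>
  have "rescaled (Suc n) x - rescaled n x
      = scale (inverse (P (Suc n) x)) (f (\<rho> ?y) - scale (p ?y) (f ?y))"
    using p_nonzero[OF y] by (simp add: rescaled_def P_Suc scale_right_diff_distrib)
  then have "nrm (rescaled (Suc n) x - rescaled n x)
      = nrm (f (\<rho> ?y) - scale (p ?y) (f ?y)) / av (P (Suc n) x)"
    by (simp add: nrm_scale_inverse)
  also have "\<dots> \<le> \<psi> ?y / av (P (Suc n) x)"
    using f_approx[OF y] av_nonneg by (rule divide_right_mono)
  also have "\<dots> \<le> \<psi> x / av (p x) * L ^ n"
    using assms by (rule psi_iterate)
  finally show ?thesis .
qed

lemma rescaled_bound:
  assumes "x \<in> S"
  shows "nrm (rescaled n x - f x) \<le> \<Theta> n x"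
proof -
  have "rescaled 0 x = f x"
    by (simp add: rescaled_def P_def)
  then show ?thesis
    using geometric_steps_bound[OF rescaled_step[OF assms] L_pos L_less_1, of 0 n]
    by (simp add: \<Theta>_def mult_ac)
qed

text \<open>The limit is known to exist only for \<open>x\<close> in \<open>S\<close>; elsewhere the
  chosen value is not controlled, and the final proof restricts to \<open>S\<close>.\<close>

definition solution :: "'s \<Rightarrow> 'b"
  where "solution x = (SOME l. (\<lambda>n. nrm (rescaled n x - l)) \<longlonglongrightarrow> 0)"

lemma rescaled_tendsto: "x \<in> S \<Longrightarrow> (\<lambda>n. nrm (rescaled n x - solution x)) \<longlonglongrightarrow> 0"
  unfolding solution_def
  by (rule someI_ex) (rule geometric_steps_converge[OF rescaled_step L_pos L_less_1])

text \<open>Rescaling at \<open>\<rho> x\<close> is \<open>p x\<close> times the rescaling at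
  \<open>x\<close> with index shifted by one, so both sides are limits of the same sequence.\<close>

lemma solution_eq:
  assumes "x \<in> S"
  shows "solution (\<rho> x) = scale (p x) (solution x)"
proof (rule nrm_limit_unique)
  show "(\<lambda>n. nrm (rescaled n (\<rho> x) - solution (\<rho> x))) \<longlonglongrightarrow> 0"
    using assms by (intro rescaled_tendsto rho_maps)
  have "rescaled n (\<rho> x) = scale (p x) (rescaled (Suc n) x)" for n
    using p_nonzero[OF assms] by (simp add: rescaled_def P_Suc_left funpow_swap1)
  then have "nrm (rescaled n (\<rho> x) - scale (p x) (solution x))
      = av (p x) * nrm (rescaled (Suc n) x - solution x)" for n
    by (simp add: nrm_scale flip: scale_right_diff_distrib)
  then show "(\<lambda>n. nrm (rescaled n (\<rho> x) - scale (p x) (solution x))) \<longlonglongrightarrow> 0"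
    using tendsto_mult_left[OF LIMSEQ_Suc[OF rescaled_tendsto[OF assms]], of "av (p x)"] by simp
qed

text \<open>Pass to the limit in \<open>rescaled_bound\<close>: the term \<open>L ^ n\<close> in
  \<open>\<Theta> n x\<close> vanishes.\<close>

lemma solution_bound:
  assumes "x \<in> S"
  shows "nrm (f x - solution x) \<le> \<psi> x / ((1 - L) * av (p x))"
proof -
  have "(\<lambda>n. \<Theta> n x + nrm (rescaled n x - solution x)) \<longlonglongrightarrow> ((1 - 0) * \<psi> x) / ((1 - L) * av (p x)) + 0"
    unfolding \<Theta>_def using L_pos L_less_1 av_pos[OF p_nonzero[OF assms]]
    by (intro tendsto_intros rescaled_tendsto assms LIMSEQ_realpow_zero) auto
  moreover have "nrm (f x - solution x) \<le> \<Theta> n x + nrm (rescaled n x - solution x)" for n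
    using triangle[of "f x" "rescaled n x" "solution x"] commute[of "f x" "rescaled n x"]
      rescaled_bound[OF assms, of n] by simp
  ultimately show ?thesis
    by (intro LIMSEQ_le_const[of _ _ "nrm (f x - solution x)"]) auto
qed

text \<open>Since \<open>T\<close> scales exactly by \<open>P n x\<close> along the orbit,
  \<open>rescaled n x - T x\<close> is \<open>f - T\<close> at the \<open>n\<close>-th iterate
  divided by \<open>P n x\<close>. The assumed bound at that iterate and \<open>psi_iterate\<close>
  force it to 0.\<close>

lemma solution_unique:
  assumes eq: "\<And>y. y \<in> S \<Longrightarrow> T (\<rho> y) = scale (p y) (T y)"
    and bound: "\<And>y. y \<in> S \<Longrightarrow> nrm (f y - T y) \<le> \<psi> y / ((1 - L) * av (p y))"
    and x: "x \<in> S"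
  shows "T x = solution x"
proof (rule nrm_limit_unique[OF _ rescaled_tendsto[OF x]])
  have iterate: "T ((\<rho> ^^ n) x) = scale (P n x) (T x)" for n
    by (induction n) (simp_all add: P_def[of 0] P_Suc eq funpow_maps x)
  have "nrm (rescaled n x - T x) \<le> \<psi> x / av (p x) * L ^ n / (1 - L)" for n
  proof -
    let ?y = "(\<rho> ^^ n) x"
    have y: "?y \<in> S" using x by (rule funpow_maps)
    have "rescaled n x - T x = scale (inverse (P n x)) (f ?y - T ?y)"
      using P_nonzero[OF x, of n] by (simp add: rescaled_def iterate scale_right_diff_distrib)
    then have "nrm (rescaled n x - T x) = nrm (f ?y - T ?y) / av (P n x)"
      by (simp add: nrm_scale_inverse)
    also have "\<dots> \<le> \<psi> ?y / ((1 - L) * av (p ?y)) / av (P n x)"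
      using bound[OF y] av_nonneg by (rule divide_right_mono)
    \<comment> \<open>The denominator \<open>av (p ?y)\<close> completes \<open>P n x\<close> to
      \<open>P (Suc n) x\<close>, the form that \<open>psi_iterate\<close> treats.\<close>
    also have "\<dots> = \<psi> ?y / av (P (Suc n) x) / (1 - L)"
      by (simp add: P_Suc av_mult mult_ac)
    also have "\<dots> \<le> \<psi> x / av (p x) * L ^ n / (1 - L)"
      using psi_iterate[OF x] L_less_1 by (intro divide_right_mono) auto
    finally show ?thesis .
  qed
  then have "\<forall>\<^sub>F n in sequentially. nrm (rescaled n x - T x) \<le> \<psi> x / av (p x) * L ^ n / (1 - L)"
    by (rule always_eventually[OF allI])
  moreover have "(\<lambda>n. \<psi> x / av (p x) * L ^ n / (1 - L)) \<longlonglongrightarrow> \<psi> x / av (p x) * 0 / (1 - L)"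
    using L_pos L_less_1 by (intro tendsto_intros LIMSEQ_realpow_zero) auto
  then have "(\<lambda>n. \<psi> x / av (p x) * L ^ n / (1 - L)) \<longlonglongrightarrow> 0"
    by simp
  ultimately show "(\<lambda>n. nrm (rescaled n x - T x)) \<longlonglongrightarrow> 0"
    by (rule tendsto_sandwich[OF always_eventually[OF allI[OF nrm_nonneg]] _ tendsto_const])
qed

end

section \<open>Several equations: commuting iterates and agreement of the solutions\<close>

lemma funpow_commute_on:
  assumes "r \<in> S \<rightarrow> S" and "\<And>x. x \<in> S \<Longrightarrow> r (s x) = s (r x)" and "x \<in> S"
  shows "(r ^^ n) x \<in> S \<and> s ((r ^^ n) x) = (r ^^ n) (s x)"
\<comment> \<open>Commutation is known only on \<open>S\<close>, so membership is carried through
  the induction.\<close>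
proof (induction n)
  case (Suc n)
  then show ?case using assms(1) assms(2)[of "(r ^^ n) x"] by auto
qed (use assms in simp)

text \<open>\<open>funpow_commute_on\<close> is used twice: first to move a single \<open>s\<close>
  past \<open>r ^^ m\<close>, then with \<open>r ^^ m\<close> as the single map and \<open>s\<close>
  iterated.\<close>

lemma funpow_funpow_commute_on:
  assumes "r \<in> S \<rightarrow> S" and "s \<in> S \<rightarrow> S" and "\<And>x. x \<in> S \<Longrightarrow> r (s x) = s (r x)" and "x \<in> S"
  shows "(r ^^ m) ((s ^^ n) x) = (s ^^ n) ((r ^^ m) x)"
proof (rule funpow_commute_on[where S = S, THEN conjunct2])
  show "s ((r ^^ m) y) = (r ^^ m) (s y)" if "y \<in> S" for y
    using funpow_commute_on[of r S s y m] assms(1,3) that by blast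
qed (use assms in auto)

lemma funpow_invariant_on:
  assumes "s \<in> S \<rightarrow> S" and "\<And>x. x \<in> S \<Longrightarrow> q (s x) = q x" and "x \<in> S"
  shows "(s ^^ n) x \<in> S \<and> q ((s ^^ n) x) = q x"
  by (induction n) (use assms in auto)

theorem theorem5p10:
  fixes S :: "'s set" and I :: "'i set"
    and av :: "'f::field \<Rightarrow> real"
    and scale :: "'f \<Rightarrow> 'b::ab_group_add \<Rightarrow> 'b" and nrm :: "'b \<Rightarrow> real"
    and p :: "'i \<Rightarrow> 's \<Rightarrow> 'f" and \<rho> :: "'i \<Rightarrow> 's \<Rightarrow> 's" and \<psi> :: "'i \<Rightarrow> 's \<Rightarrow> real"
    and L :: "'i \<Rightarrow> real" and f :: "'s \<Rightarrow> 'b"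
  assumes F: "rat_real_complex_abs av"
    and B: "banach_space_over scale av nrm"
    and S_nonempty: "S \<noteq> {}" and I_nonempty: "I \<noteq> {}"
    and p_nonzero: "\<And>i x. i \<in> I \<Longrightarrow> x \<in> S \<Longrightarrow> p i x \<noteq> 0"
    and rho_maps: "\<And>i. i \<in> I \<Longrightarrow> \<rho> i \<in> S \<rightarrow> S"
    and psi_nonneg: "\<And>i x. i \<in> I \<Longrightarrow> x \<in> S \<Longrightarrow> 0 \<le> \<psi> i x"
    and L_bounds: "\<And>i. i \<in> I \<Longrightarrow> 0 < L i \<and> L i < 1"
    and psi_contr: "\<And>i x. i \<in> I \<Longrightarrow> x \<in> S \<Longrightarrow> \<psi> i (\<rho> i x) \<le> L i * av (p i (\<rho> i x)) * \<psi> i x"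
    and rho_commute: "\<And>i j x. i \<in> I \<Longrightarrow> j \<in> I \<Longrightarrow> x \<in> S \<Longrightarrow> \<rho> i (\<rho> j x) = \<rho> j (\<rho> i x)"
    and p_invariant: "\<And>i j x. i \<in> I \<Longrightarrow> j \<in> I \<Longrightarrow> i \<noteq> j \<Longrightarrow> x \<in> S \<Longrightarrow> p i (\<rho> j x) = p i x"
    and theta_limit: "\<And>i j x. i \<in> I \<Longrightarrow> j \<in> I \<Longrightarrow> i \<noteq> j \<Longrightarrow> x \<in> S \<Longrightarrow>
      (\<lambda>n. theta av p \<psi> L i n ((\<rho> j ^^ n) x) / av (iter_prod p \<rho> j n x)) \<longlonglongrightarrow> 0"
    and f_approx: "\<And>i x. i \<in> I \<Longrightarrow> x \<in> S \<Longrightarrow> nrm (f (\<rho> i x) - scale (p i x) (f x)) \<le> \<psi> i x"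
  shows "\<exists>!T. T \<in> S \<rightarrow>\<^sub>E UNIV \<and>
    (\<forall>i\<in>I. \<forall>x\<in>S. T (\<rho> i x) = scale (p i x) (T x)) \<and>
    (\<forall>x\<in>S. nrm (f x - T x) \<le> (INF i\<in>I. \<psi> i x / ((1 - L i) * av (p i x))))"
proof -
  interpret banach_space_over scale av nrm by (rule B)
  interpret valued_banach_space scale av nrm by unfold_locales (rule F)
  have A: "approx_equation scale av nrm S (p i) (\<rho> i) (\<psi> i) (L i) f" if "i \<in> I" for i
    using that p_nonzero rho_maps L_bounds psi_contr f_approx by unfold_locales auto
  define g where "g i = approx_equation.rescaled scale (p i) (\<rho> i) f" for i
  define sol where "sol i = approx_equation.solution scale nrm (p i) (\<rho> i) f" for i
  have P_eq: "approx_equation.P (p i) (\<rho> i) = iter_prod p \<rho> i" if "i \<in> I" for i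
    by (intro ext) (simp add: approx_equation.P_def[OF A[OF that]] iter_prod_def)
  have g_eq: "g i n x = scale (inverse (iter_prod p \<rho> i n x)) (f ((\<rho> i ^^ n) x))" if "i \<in> I" for i n x
    by (simp add: g_def approx_equation.rescaled_def[OF A[OF that]] P_eq that)
  have g_bound: "nrm (g i n x - f x) \<le> theta av p \<psi> L i n x" if "i \<in> I" "x \<in> S" for i n x
    using approx_equation.rescaled_bound[OF A that(2)] that(1)
    by (simp add: g_def theta_def approx_equation.\<Theta>_def[OF A])
  have g_lim: "(\<lambda>n. nrm (g i n x - sol i x)) \<longlonglongrightarrow> 0" if "i \<in> I" "x \<in> S" for i x
    unfolding g_def sol_def by (rule approx_equation.rescaled_tendsto[OF A[OF that(1)] that(2)])

  define h where "h i j n x =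
    scale (inverse (iter_prod p \<rho> i n x * iter_prod p \<rho> j n x)) (f ((\<rho> i ^^ n) ((\<rho> j ^^ n) x)))" for i j n x
  have h_sym: "h i j n x = h j i n x" if "i \<in> I" "j \<in> I" "x \<in> S" for i j n x
  proof -
    have "(\<rho> i ^^ n) ((\<rho> j ^^ n) x) = (\<rho> j ^^ n) ((\<rho> i ^^ n) x)"
      using that by (intro funpow_funpow_commute_on[of _ S] rho_maps rho_commute)
    then show ?thesis
      unfolding h_def by (simp only: mult.commute[of "iter_prod p \<rho> i n x"])
  qed
  have h_close: "(\<lambda>n. nrm (h i j n x - g j n x)) \<longlonglongrightarrow> 0"
    if ij: "i \<in> I" "j \<in> I" "i \<noteq> j" and x: "x \<in> S" for i j x
  proof (rule tendsto_sandwich[OF _ _ tendsto_const theta_limit[OF ij x]])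
    have "nrm (h i j n x - g j n x)
        \<le> theta av p \<psi> L i n ((\<rho> j ^^ n) x) / av (iter_prod p \<rho> j n x)" for n
    proof -
      let ?y = "(\<rho> j ^^ n) x"
      have y: "?y \<in> S"
        using approx_equation.funpow_maps[OF A[OF ij(2)] x] .
      \<comment> \<open>The iterate of \<open>\<rho> j\<close> is moved outermost, where
        \<open>p_invariant\<close> removes it. Hence \<open>h i j n x\<close> is
        \<open>g i n ?y\<close> divided by the \<open>j\<close>-product at \<open>x\<close>.\<close>
      have "p i ((\<rho> i ^^ k) ?y) = p i ((\<rho> i ^^ k) x)" for k
      proof -
        have "(\<rho> i ^^ k) ?y = (\<rho> j ^^ n) ((\<rho> i ^^ k) x)"
          using ij x by (intro funpow_funpow_commute_on[of _ S] rho_maps rho_commute)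
        then show ?thesis
          using funpow_invariant_on[of "\<rho> j" S "p i" "(\<rho> i ^^ k) x" n] ij rho_maps p_invariant
            approx_equation.funpow_maps[OF A[OF ij(1)] x] by simp
      qed
      then have "iter_prod p \<rho> i n ?y = iter_prod p \<rho> i n x"
        by (simp add: iter_prod_def)
      then have "h i j n x - g j n x = scale (inverse (iter_prod p \<rho> j n x)) (g i n ?y - f ?y)"
        using ij by (simp add: h_def g_eq scale_right_diff_distrib mult.commute)
      then have "nrm (h i j n x - g j n x) = nrm (g i n ?y - f ?y) / av (iter_prod p \<rho> j n x)"
        by (simp add: nrm_scale_inverse)
      also have "\<dots> \<le> theta av p \<psi> L i n ?y / av (iter_prod p \<rho> j n x)"
        using g_bound[OF ij(1) y] av_nonneg by (rule divide_right_mono)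
      finally show ?thesis .
    qed
    then show "\<forall>\<^sub>F n in sequentially. nrm (h i j n x - g j n x)
        \<le> theta av p \<psi> L i n ((\<rho> j ^^ n) x) / av (iter_prod p \<rho> j n x)"
      by simp
  qed (simp add: nrm_nonneg)
  have h_lim: "(\<lambda>n. nrm (h i j n x - sol j x)) \<longlonglongrightarrow> 0"
    if "i \<in> I" "j \<in> I" "i \<noteq> j" "x \<in> S" for i j x
  proof (rule tendsto_sandwich[OF _ _ tendsto_const])
    show "(\<lambda>n. nrm (h i j n x - g j n x) + nrm (g j n x - sol j x)) \<longlonglongrightarrow> 0"
      using tendsto_add[OF h_close g_lim] that by fastforce
    show "\<forall>\<^sub>F n in sequentially. nrm (h i j n x - sol j x)
        \<le> nrm (h i j n x - g j n x) + nrm (g j n x - sol j x)"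
      using triangle by simp
  qed (simp add: nrm_nonneg)
  have sol_indep: "sol i x = sol j x" if "i \<in> I" "j \<in> I" "x \<in> S" for i j x
  proof (cases "i = j")
    case False
    \<comment> \<open>\<open>h_lim\<close> with the roles of \<open>i\<close> and \<open>j\<close>
      swapped concerns \<open>h j i\<close>; \<open>h_sym\<close> turns it into a second limit of
      \<open>h i j\<close>.\<close>
    have "(\<lambda>n. nrm (h i j n x - sol i x)) \<longlonglongrightarrow> 0"
      using h_lim[of j i x] h_sym that False by simp
    then show ?thesis
      using h_lim[OF that(1,2) False that(3)] by (rule nrm_limit_unique)
  qed simp

  have sol_bound: "nrm (f x - sol i x) \<le> \<psi> i x / ((1 - L i) * av (p i x))" if "i \<in> I" "x \<in> S" for i x
    unfolding sol_def by (rule approx_equation.solution_bound[OF A[OF that(1)] that(2)])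
  \<comment> \<open>A real infimum lies below its terms only if they are bounded below; 0 works
    because each term dominates a norm.\<close>
  have bdd: "bdd_below ((\<lambda>i. \<psi> i x / ((1 - L i) * av (p i x))) ` I)" if "x \<in> S" for x
    using sol_bound nrm_nonneg that by (intro bdd_belowI2[of _ 0]) (meson order_trans)
  obtain i0 where i0: "i0 \<in> I"
    using I_nonempty by blast
  \<comment> \<open>Membership in \<open>S \<rightarrow>\<^sub>E UNIV\<close> fixes the value
    outside \<open>S\<close>, so uniqueness means uniqueness on \<open>S\<close>. By
    \<open>sol_indep\<close> the solution for \<open>i0\<close> serves every index.\<close>
  show ?thesis
  proof (intro ex1I[of _ "restrict (sol i0) S"] conjI ballI)
    show "restrict (sol i0) S \<in> S \<rightarrow>\<^sub>E UNIV"
      by simp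
    show "restrict (sol i0) S (\<rho> i x) = scale (p i x) (restrict (sol i0) S x)"
      if "i \<in> I" "x \<in> S" for i x
    proof -
      have "\<rho> i x \<in> S"
        using rho_maps that by auto
      moreover have "sol i (\<rho> i x) = scale (p i x) (sol i x)"
        unfolding sol_def by (rule approx_equation.solution_eq[OF A[OF that(1)] that(2)])
      ultimately show ?thesis
        using sol_indep[OF i0 that(1)] that(2) by simp
    qed
    show "nrm (f x - restrict (sol i0) S x) \<le> (INF i\<in>I. \<psi> i x / ((1 - L i) * av (p i x)))"
      if "x \<in> S" for x
      using I_nonempty sol_bound sol_indep[OF i0 _ that] that by (intro cINF_greatest) auto
  next
    fix T
    assume T: "T \<in> S \<rightarrow>\<^sub>E UNIV \<and>
      (\<forall>i\<in>I. \<forall>x\<in>S. T (\<rho> i x) = scale (p i x) (T x)) \<and>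
      (\<forall>x\<in>S. nrm (f x - T x) \<le> (INF i\<in>I. \<psi> i x / ((1 - L i) * av (p i x))))"
    \<comment> \<open>The infimum is at most its \<open>i0\<close> term, which brings
      \<open>T\<close> under the uniqueness result for the index \<open>i0\<close>.\<close>
    have "nrm (f x - T x) \<le> \<psi> i0 x / ((1 - L i0) * av (p i0 x))" if "x \<in> S" for x
      using T that cINF_lower[OF bdd[OF that] i0] by (blast intro: order_trans)
    then have "T x = sol i0 x" if "x \<in> S" for x
      unfolding sol_def using T i0 that by (intro approx_equation.solution_unique[OF A]) auto
    then show "T = restrict (sol i0) S"
      using T by (intro extensionalityI[of _ S]) (auto simp: PiE_def)
  qed
qed

end
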